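(* Let $(\mathfrak g,\omega)$ be a completely reducible symplectic Lie algebra. Then $(\mathfrak g,\omega)$ has a Lagrangian subalgebra. In particular, $(\mathfrak g,\omega)$ has a Lagrangian subalgebra whenever $(\mathfrak g,\omega)$ is a symplectic Lie algebra with $\mathfrak g$ completely solvable (in particular, whenever $\mathfrak g$ is nilpotent).
   Context: All Lie algebras are finite-dimensional over a fixed field $k$ of characteristic $0$. A symplectic Lie algebra $(\mathfrak g,\omega)$ is a Lie algebra $\mathfrak g$ with a non-degenerate alternating form $\omega$ satisfying $\omega([u,v],w)+\omega([w,u],v)+\omega([v,w],u)=0$ for all $u,v,w$. For a subspace $W$, $W^{\perp_\omega}=\{v:\omega(v,w)=0\ \forall w\in W\}$; $W$ is isotropic if $W\subseteq W^{\perp_\omega}$ and Lagrangian if $W=W^{\perp_\omega}$. A Lagrangian subalgebra is a Lie subalgebra that is a Lagrangian subspace. A Lie algebra is completely solvable if it admits a complete flag of ideals (a chain of ideals with one ideal in each dimension). If $\mathfrak j$ is an isotropic ideal of $(\mathfrak g,\omega)$, then $\mathfrak j^{\perp_\omega}$ is a subalgebra containing $\mathfrak j$ as an ideal, and $\omega$ induces a symplectic form on $\mathfrak j^{\perp_\omega}/\mathfrak j$; the resulting symplectic Lie algebra is the symplectic reduction of $(\mathfrak g,\omega)$ with respect to $\mathfrak j$. A symplectic Lie algebra is completely reducible if there is a finite sequence of symplectic Lie algebras starting with it, each term being a symplectic reduction of the preceding one, and ending with the trivial symplectic Lie algebra $\{0\}$. *)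

theory Defs
  imports "Jordan_Normal_Form.Missing_VectorSpace" "HOL-Algebra.AbelCoset"
begin

text \<open>
  Vector spaces are the \<open>vectorspace\<close> records over a field record \<open>K\<close>; as usual for module records,
  the inherited fields \<open>mult\<close> and \<open>one\<close> carry no meaning.
\<close>

record ('a, 'b) lie_algebra = "('a, 'b) module" +
  bracket :: "'b \<Rightarrow> 'b \<Rightarrow> 'b"

text \<open>
  Finite dimension and characteristic \<open>0\<close> are standing assumptions, hence part of the locale.
\<close>

locale lie_algebra = vectorspace K L
  for K :: "('a, 'r) ring_scheme" and L :: "('a, 'b, 'm) lie_algebra_scheme" (structure) +
  assumes char_zero: "\<And>n::nat. 0 < n \<Longrightarrow> [n] \<cdot>\<^bsub>K\<^esub> \<one>\<^bsub>K\<^esub> \<noteq> \<zero>\<^bsub>K\<^esub>"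
    and finite_dimensional: "fin_dim"
    and bracket_closed: "\<And>u v. \<lbrakk>u \<in> carrier L; v \<in> carrier L\<rbrakk> \<Longrightarrow> bracket L u v \<in> carrier L"
    and bracket_add_left:
      "\<And>u v w. \<lbrakk>u \<in> carrier L; v \<in> carrier L; w \<in> carrier L\<rbrakk>
        \<Longrightarrow> bracket L (u \<oplus> v) w = bracket L u w \<oplus> bracket L v w"
    and bracket_add_right:
      "\<And>u v w. \<lbrakk>u \<in> carrier L; v \<in> carrier L; w \<in> carrier L\<rbrakk>
        \<Longrightarrow> bracket L u (v \<oplus> w) = bracket L u v \<oplus> bracket L u w"
    and bracket_smult_left:
      "\<And>a u v. \<lbrakk>a \<in> carrier K; u \<in> carrier L; v \<in> carrier L\<rbrakk>
        \<Longrightarrow> bracket L (a \<odot> u) v = a \<odot> bracket L u v"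
    and bracket_smult_right:
      "\<And>a u v. \<lbrakk>a \<in> carrier K; u \<in> carrier L; v \<in> carrier L\<rbrakk>
        \<Longrightarrow> bracket L u (a \<odot> v) = a \<odot> bracket L u v"
    and bracket_alternating: "\<And>u. u \<in> carrier L \<Longrightarrow> bracket L u u = \<zero>"
    and jacobi:
      "\<And>u v w. \<lbrakk>u \<in> carrier L; v \<in> carrier L; w \<in> carrier L\<rbrakk>
        \<Longrightarrow> bracket L u (bracket L v w) \<oplus> bracket L v (bracket L w u) \<oplus> bracket L w (bracket L u v) = \<zero>"

locale symplectic_lie_algebra = lie_algebra K L
  for K :: "('a, 'r) ring_scheme" and L :: "('a, 'b, 'm) lie_algebra_scheme" (structure) +
  fixes \<omega> :: "'b \<Rightarrow> 'b \<Rightarrow> 'a"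
  assumes form_closed: "\<And>u v. \<lbrakk>u \<in> carrier L; v \<in> carrier L\<rbrakk> \<Longrightarrow> \<omega> u v \<in> carrier K"
    and form_add_left:
      "\<And>u v w. \<lbrakk>u \<in> carrier L; v \<in> carrier L; w \<in> carrier L\<rbrakk> \<Longrightarrow> \<omega> (u \<oplus> v) w = \<omega> u w \<oplus>\<^bsub>K\<^esub> \<omega> v w"
    and form_add_right:
      "\<And>u v w. \<lbrakk>u \<in> carrier L; v \<in> carrier L; w \<in> carrier L\<rbrakk> \<Longrightarrow> \<omega> u (v \<oplus> w) = \<omega> u v \<oplus>\<^bsub>K\<^esub> \<omega> u w"
    and form_smult_left:
      "\<And>a u v. \<lbrakk>a \<in> carrier K; u \<in> carrier L; v \<in> carrier L\<rbrakk> \<Longrightarrow> \<omega> (a \<odot> u) v = a \<otimes>\<^bsub>K\<^esub> \<omega> u v"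
    and form_smult_right:
      "\<And>a u v. \<lbrakk>a \<in> carrier K; u \<in> carrier L; v \<in> carrier L\<rbrakk> \<Longrightarrow> \<omega> u (a \<odot> v) = a \<otimes>\<^bsub>K\<^esub> \<omega> u v"
    and form_alternating: "\<And>u. u \<in> carrier L \<Longrightarrow> \<omega> u u = \<zero>\<^bsub>K\<^esub>"
    and form_nondegenerate: "\<And>v. \<lbrakk>v \<in> carrier L; \<forall>w\<in>carrier L. \<omega> v w = \<zero>\<^bsub>K\<^esub>\<rbrakk> \<Longrightarrow> v = \<zero>"
    and form_cocycle:
      "\<And>u v w. \<lbrakk>u \<in> carrier L; v \<in> carrier L; w \<in> carrier L\<rbrakk>
        \<Longrightarrow> \<omega> (bracket L u v) w \<oplus>\<^bsub>K\<^esub> \<omega> (bracket L w u) v \<oplus>\<^bsub>K\<^esub> \<omega> (bracket L v w) u = \<zero>\<^bsub>K\<^esub>"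

definition lie_subalgebra ::
    "('a, 'r) ring_scheme \<Rightarrow> ('a, 'b, 'm) lie_algebra_scheme \<Rightarrow> 'b set \<Rightarrow> bool" where
  "lie_subalgebra K L H \<longleftrightarrow> subspace K H L \<and> (\<forall>x\<in>H. \<forall>y\<in>H. bracket L x y \<in> H)"

definition lie_ideal ::
    "('a, 'r) ring_scheme \<Rightarrow> ('a, 'b, 'm) lie_algebra_scheme \<Rightarrow> 'b set \<Rightarrow> bool" where
  "lie_ideal K L J \<longleftrightarrow> subspace K J L \<and> (\<forall>x\<in>carrier L. \<forall>y\<in>J. bracket L x y \<in> J)"

definition orth ::
    "('a, 'r) ring_scheme \<Rightarrow> ('a, 'b, 'm) lie_algebra_scheme \<Rightarrow> ('b \<Rightarrow> 'b \<Rightarrow> 'a) \<Rightarrow> 'b set \<Rightarrow> 'b set" where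
  "orth K L \<omega> W = {v \<in> carrier L. \<forall>w\<in>W. \<omega> v w = \<zero>\<^bsub>K\<^esub>}"

definition isotropic ::
    "('a, 'r) ring_scheme \<Rightarrow> ('a, 'b, 'm) lie_algebra_scheme \<Rightarrow> ('b \<Rightarrow> 'b \<Rightarrow> 'a) \<Rightarrow> 'b set \<Rightarrow> bool" where
  "isotropic K L \<omega> W \<longleftrightarrow> subspace K W L \<and> W \<subseteq> orth K L \<omega> W"

definition lagrangian ::
    "('a, 'r) ring_scheme \<Rightarrow> ('a, 'b, 'm) lie_algebra_scheme \<Rightarrow> ('b \<Rightarrow> 'b \<Rightarrow> 'a) \<Rightarrow> 'b set \<Rightarrow> bool" where
  "lagrangian K L \<omega> W \<longleftrightarrow> subspace K W L \<and> W = orth K L \<omega> W"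

definition lagrangian_subalgebra ::
    "('a, 'r) ring_scheme \<Rightarrow> ('a, 'b, 'm) lie_algebra_scheme \<Rightarrow> ('b \<Rightarrow> 'b \<Rightarrow> 'a) \<Rightarrow> 'b set \<Rightarrow> bool" where
  "lagrangian_subalgebra K L \<omega> H \<longleftrightarrow> lie_subalgebra K L H \<and> lagrangian K L \<omega> H"

text \<open>
  The quotient by an ideal \<open>J\<close>, on the set of cosets. Scalar multiple and bracket of cosets are
  formed as in the library's \<open>rcoset_mult\<close> for quotient rings: all representatives give the same
  coset, so the union is that coset.
\<close>

definition lie_quotient ::
    "('a, 'b, 'm) lie_algebra_scheme \<Rightarrow> 'b set \<Rightarrow> ('a, 'b set) lie_algebra" where
  "lie_quotient L J =
    \<lparr>carrier = a_rcosets\<^bsub>L\<^esub> J,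
     mult = (\<lambda>X Y. J),
     one = J,
     zero = J,
     add = set_add L,
     smult = (\<lambda>a X. \<Union>x\<in>X. J +>\<^bsub>L\<^esub> (a \<odot>\<^bsub>L\<^esub> x)),
     bracket = (\<lambda>X Y. \<Union>x\<in>X. \<Union>y\<in>Y. J +>\<^bsub>L\<^esub> bracket L x y)\<rparr>"

definition quotient_form :: "('b \<Rightarrow> 'b \<Rightarrow> 'a) \<Rightarrow> 'b set \<Rightarrow> 'b set \<Rightarrow> 'a" where
  "quotient_form \<omega> X Y = the_elem ((\<lambda>(x, y). \<omega> x y) ` (X \<times> Y))"

definition reduction ::
    "('a, 'r) ring_scheme \<Rightarrow> ('a, 'b, 'm) lie_algebra_scheme \<Rightarrow> ('b \<Rightarrow> 'b \<Rightarrow> 'a) \<Rightarrow> 'b set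
      \<Rightarrow> ('a, 'b set) lie_algebra" where
  "reduction K L \<omega> J = lie_quotient (L\<lparr>carrier := orth K L \<omega> J\<rparr>) J"

definition symplectic_isomorphic ::
    "('a, 'r) ring_scheme \<Rightarrow> ('a, 'b, 'm) lie_algebra_scheme \<Rightarrow> ('b \<Rightarrow> 'b \<Rightarrow> 'a)
      \<Rightarrow> ('a, 'c, 'n) lie_algebra_scheme \<Rightarrow> ('c \<Rightarrow> 'c \<Rightarrow> 'a) \<Rightarrow> bool" where
  "symplectic_isomorphic K L \<omega> L' \<omega>' \<longleftrightarrow>
    (\<exists>f \<in> module_hom K L L'. bij_betw f (carrier L) (carrier L') \<and>
      (\<forall>u\<in>carrier L. \<forall>v\<in>carrier L. f (bracket L u v) = bracket L' (f u) (f v)) \<and>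
      (\<forall>u\<in>carrier L. \<forall>v\<in>carrier L. \<omega>' (f u) (f v) = \<omega> u v))"

text \<open>
  The carrier type of the reduction itself is \<open>'b set\<close>, so a chain of literal reductions has no
  single type. Each reduction is therefore transported along an isomorphism of symplectic Lie
  algebras. All terms of a chain can be kept inside the type \<open>'b\<close> of the initial one without loss
  of generality, since a set of cosets injects into the set it partitions.
\<close>

definition is_symplectic_reduction ::
    "('a, 'r) ring_scheme \<Rightarrow> ('a, 'b, 'm) lie_algebra_scheme \<Rightarrow> ('b \<Rightarrow> 'b \<Rightarrow> 'a)
      \<Rightarrow> ('a, 'c, 'n) lie_algebra_scheme \<Rightarrow> ('c \<Rightarrow> 'c \<Rightarrow> 'a) \<Rightarrow> bool" where
  "is_symplectic_reduction K L \<omega> L' \<omega>' \<longleftrightarrow>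
    (\<exists>J. lie_ideal K L J \<and> isotropic K L \<omega> J \<and>
      symplectic_isomorphic K (reduction K L \<omega> J) (quotient_form \<omega>) L' \<omega>')"

definition completely_reducible ::
    "('a, 'r) ring_scheme \<Rightarrow> ('a, 'b, 'm) lie_algebra_scheme \<Rightarrow> ('b \<Rightarrow> 'b \<Rightarrow> 'a) \<Rightarrow> bool" where
  "completely_reducible K L \<omega> \<longleftrightarrow>
    (\<exists>(n::nat) Ls \<omega>s.
      Ls 0 = L \<and> \<omega>s 0 = \<omega> \<and>
      (\<forall>i\<le>n. symplectic_lie_algebra K (Ls i) (\<omega>s i)) \<and>
      (\<forall>i<n. is_symplectic_reduction K (Ls i) (\<omega>s i) (Ls (Suc i)) (\<omega>s (Suc i))) \<and>
      carrier (Ls n) = {\<zero>\<^bsub>Ls n\<^esub>})"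

definition completely_solvable ::
    "('a, 'r) ring_scheme \<Rightarrow> ('a, 'b, 'm) lie_algebra_scheme \<Rightarrow> bool" where
  "completely_solvable K L \<longleftrightarrow>
    (\<exists>F :: nat \<Rightarrow> 'b set.
      (\<forall>i\<le>vectorspace.dim K L. lie_ideal K L (F i) \<and> vectorspace.dim K (L\<lparr>carrier := F i\<rparr>) = i) \<and>
      (\<forall>i<vectorspace.dim K L. F i \<subseteq> F (Suc i)))"

primrec lower_central_series ::
    "('a, 'r) ring_scheme \<Rightarrow> ('a, 'b, 'm) lie_algebra_scheme \<Rightarrow> nat \<Rightarrow> 'b set" where
  "lower_central_series K L 0 = carrier L"
| "lower_central_series K L (Suc i) =
    module.span K L {bracket L x y | x y. x \<in> carrier L \<and> y \<in> lower_central_series K L i}"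

definition nilpotent :: "('a, 'r) ring_scheme \<Rightarrow> ('a, 'b, 'm) lie_algebra_scheme \<Rightarrow> bool" where
  "nilpotent K L \<longleftrightarrow> (\<exists>n. lower_central_series K L n = {\<zero>\<^bsub>L\<^esub>})"

end

theory Submission
  imports Defs
begin

text \<open>
  If \<open>J\<close> is an isotropic ideal, the preimage of a Lagrangian subalgebra under
  \<open>J\<^sup>\<bottom> \<rightarrow> J\<^sup>\<bottom>/J\<close> is a Lagrangian subalgebra, so one can be pulled back along a chain of reductions
  ending in \<open>{0}\<close>.

  For completely solvable algebras no reduction is needed: given a complete flag of ideals
  \<open>F\<^sub>i\<close>, Vergne's polarization \<open>\<Sum>\<^sub>i F\<^sub>i \<inter> F\<^sub>i\<^sup>\<bottom>\<close> is a Lagrangian subspace, and the cocycle identity gives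
  \<open>[F\<^sub>j \<inter> F\<^sub>j\<^sup>\<bottom>, F\<^sub>i \<inter> F\<^sub>i\<^sup>\<bottom>] \<subseteq> F\<^sub>i \<inter> F\<^sub>i\<^sup>\<bottom>\<close> for \<open>i \<le> j\<close>, so it is a subalgebra. For nilpotent algebras the flag
  refines the lower central series.
\<close>

section \<open>Subspaces, their bases and one-dimensional extensions\<close>

context vectorspace
begin

lemma subspaceI:
  assumes "W \<subseteq> carrier V" "\<zero>\<^bsub>V\<^esub> \<in> W"
    and "\<And>v w. \<lbrakk>v \<in> W; w \<in> W\<rbrakk> \<Longrightarrow> v \<oplus>\<^bsub>V\<^esub> w \<in> W"
    and "\<And>a v. \<lbrakk>a \<in> carrier K; v \<in> W\<rbrakk> \<Longrightarrow> a \<odot>\<^bsub>V\<^esub> v \<in> W"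
  shows "subspace K W V"
  unfolding subspace_def submodule_def using assms module_axioms vectorspace_axioms by auto

lemma subspaceD:
  assumes "subspace K W V"
  shows subspace_subset: "W \<subseteq> carrier V"
    and subspace_carrier: "v \<in> W \<Longrightarrow> v \<in> carrier V"
    and subspace_zero: "\<zero>\<^bsub>V\<^esub> \<in> W"
    and subspace_add: "\<lbrakk>v \<in> W; w \<in> W\<rbrakk> \<Longrightarrow> v \<oplus>\<^bsub>V\<^esub> w \<in> W"
    and subspace_smult: "\<lbrakk>a \<in> carrier K; v \<in> W\<rbrakk> \<Longrightarrow> a \<odot>\<^bsub>V\<^esub> v \<in> W"
  using assms unfolding subspace_def submodule_def by auto

lemma subspace_neg:
  assumes "subspace K W V" "v \<in> W"
  shows "\<ominus>\<^bsub>V\<^esub> v \<in> W"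
proof -
  have "\<ominus>\<^bsub>V\<^esub> v = (\<ominus>\<^bsub>K\<^esub> \<one>\<^bsub>K\<^esub>) \<odot>\<^bsub>V\<^esub> v"
    using assms subspace_carrier[OF assms(1)] by (simp add: smult_l_minus)
  then show ?thesis using subspace_smult[OF assms(1) _ assms(2)] by simp
qed

lemma subspace_minus:
  assumes "subspace K W V" "v \<in> W" "w \<in> W"
  shows "v \<ominus>\<^bsub>V\<^esub> w \<in> W"
  unfolding a_minus_def using assms subspace_add subspace_neg by blast

lemma subspace_Int:
  assumes "subspace K W V" "subspace K W' V"
  shows "subspace K (W \<inter> W') V"
  using assms by (intro subspaceI) (auto dest: subspaceD)

lemma carrier_subspace: "subspace K (carrier V) V"
  by (intro subspaceI) auto

lemma zero_subspace: "subspace K {\<zero>\<^bsub>V\<^esub>} V"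
  by (intro subspaceI) auto

text \<open>Independence and span inside \<open>W\<close> agree with those in \<open>V\<close>, so
  independent subsets of \<open>W\<close> have at most \<open>dim\<close> elements. A maximal one
  therefore exists, and it is a basis of \<open>W\<close>.\<close>

lemma subspace_finite_basis:
  assumes fd: fin_dim and W: "subspace K W V"
  obtains B where "finite B" "B \<subseteq> W" "lin_indpt B" "span B = W" "card B = vectorspace.dim K (vs W)"
proof -
  interpret W: vectorspace K "vs W" by (rule subspace_is_vs[OF W])
  have Wc: "W \<subseteq> carrier V" by (rule subspace_subset[OF W])
  have sub: "submodule K W V" using W by simp
  have li: "W.lin_dep S = lin_dep S" and sp: "W.span S = span S" if "S \<subseteq> W" for S
    using span_li_not_depend[OF that sub] by auto
  have "finite S \<and> card S \<le> dim" if "S \<subseteq> carrier (vs W) \<and> W.lin_indpt S" for S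
  proof -
    have "S \<subseteq> carrier V" "lin_indpt S" using that Wc li[of S] by auto
    then show ?thesis using li_le_dim[OF fd] by auto
  qed
  moreover have "{} \<subseteq> carrier (vs W) \<and> W.lin_indpt {}" unfolding W.lin_dep_def by auto
  ultimately obtain B where B: "finite B" "maximal B (\<lambda>S. S \<subseteq> carrier (vs W) \<and> W.lin_indpt S)"
    using maximal_exists[of "\<lambda>S. S \<subseteq> carrier (vs W) \<and> W.lin_indpt S" dim "{}"] by blast
  have bas: "W.basis B" by (rule W.max_li_is_basis[OF B(2)])
  have BW: "B \<subseteq> W" using bas unfolding W.basis_def by auto
  show thesis
  proof
    show "finite B" "B \<subseteq> W" by fact+
    show "lin_indpt B" using bas li[OF BW] unfolding W.basis_def by auto
    show "span B = W" using bas sp[OF BW] unfolding W.basis_def by auto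
    show "card B = W.dim" using W.dim_basis[OF B(1) bas] by simp
  qed
qed

text \<open>A basis of \<open>U\<close> together with \<open>v\<close> is independent and already
  has as many elements as the dimension of \<open>U'\<close> allows, so it spans \<open>U'\<close>.
  This is how a property known on \<open>U\<close> and at one further vector passes to all of
  \<open>U'\<close>.\<close>

lemma subspace_dim_Suc:
  assumes fd: fin_dim and U: "subspace K U V" and U': "subspace K U' V" and sub: "U \<subseteq> U'"
    and dim: "vectorspace.dim K (vs U') \<le> Suc (vectorspace.dim K (vs U))"
    and v: "v \<in> U'" "v \<notin> U" and S: "subspace K S V" "U \<subseteq> S" "v \<in> S"
  shows "U' \<subseteq> S"
proof -
  interpret U': vectorspace K "vs U'" by (rule subspace_is_vs[OF U'])
  have sub': "submodule K U' V" and subS: "submodule K S V" using U' S by auto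
  obtain B where B: "finite B" "B \<subseteq> U" "lin_indpt B" "span B = U"
    and cB: "card B = vectorspace.dim K (vs U)" by (rule subspace_finite_basis[OF fd U])
  obtain B' where B': "finite B'" "B' \<subseteq> U'" "span B' = U'" by (rule subspace_finite_basis[OF fd U'])
  have vB: "v \<notin> B" using B v by auto
  have BV: "B \<subseteq> carrier V" using B(2) subspace_subset[OF U] by auto
  have ins: "insert v B \<subseteq> U'" using B(2) sub v by auto
  have "lin_indpt (insert v B)"
    using lin_dep_iff_in_span[OF BV B(3) subspace_carrier[OF U' v(1)] vB] v B(4) by simp
  then have "U'.lin_indpt (insert v B)" using span_li_not_depend(2)[OF ins sub'] by simp
  moreover have "U'.fin_dim"
    unfolding U'.fin_dim_def using B' span_li_not_depend(1)[OF B'(2) sub'] by auto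
  ultimately have "U'.basis (insert v B)"
    using B(1) ins dim cB vB by (intro U'.dim_li_is_basis) auto
  then have "span (insert v B) = U'"
    unfolding U'.basis_def using span_li_not_depend(1)[OF ins sub'] by auto
  moreover have "span (insert v B) \<subseteq> S" using B(2) S by (intro span_is_subset[OF _ subS]) auto
  ultimately show ?thesis by simp
qed

text \<open>The extension is the span of \<open>b\<close> and a basis of \<open>U\<close>. The
  dimension bound is an inequality because \<open>b\<close> may already lie in \<open>U\<close>; the
  minimality clause later keeps the extension inside a prescribed subspace.\<close>

lemma subspace_extend:
  assumes fd: fin_dim and U: "subspace K U V" and b: "b \<in> carrier V"
  shows "\<exists>U'. subspace K U' V \<and> U \<subseteq> U' \<and> b \<in> U' \<and>
    vectorspace.dim K (vs U') \<le> Suc (vectorspace.dim K (vs U)) \<and>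
    (\<forall>S. subspace K S V \<and> U \<subseteq> S \<and> b \<in> S \<longrightarrow> U' \<subseteq> S)"
proof -
  obtain B where B: "finite B" "B \<subseteq> U" "span B = U"
    and cB: "card B = vectorspace.dim K (vs U)" by (rule subspace_finite_basis[OF fd U])
  let ?U' = "span (insert b B)"
  have bB: "insert b B \<subseteq> carrier V" using b B(2) subspace_subset[OF U] by auto
  have U': "subspace K ?U' V" by (rule span_is_subspace[OF bB])
  interpret U': vectorspace K "vs ?U'" by (rule subspace_is_vs[OF U'])
  have ins: "insert b B \<subseteq> ?U'" by (rule in_own_span[OF bB])
  show ?thesis
  proof (intro exI[of _ ?U'] conjI allI impI)
    show "subspace K ?U' V" by fact
    show "U \<subseteq> ?U'" using span_is_monotone[of B "insert b B"] B(3) by auto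
    show "b \<in> ?U'" using ins by auto
    have "U'.span (insert b B) = ?U'" using span_li_not_depend(1)[OF ins is_module[OF U']] by simp
    then have "U'.dim \<le> card (insert b B)" using B(1) ins by (intro U'.gen_ge_dim) auto
    also have "\<dots> \<le> Suc (vectorspace.dim K (vs U))"
      using B(1) by (simp add: card_insert_if flip: cB)
    finally show "U'.dim \<le> Suc (vectorspace.dim K (vs U))" .
    show "?U' \<subseteq> S" if "subspace K S V \<and> U \<subseteq> S \<and> b \<in> S" for S
      using that B(2) by (intro span_is_subset[OF _ is_module]) auto
  qed
qed

end

section \<open>Skew symmetry and two-sided ideals\<close>

context lie_algebra
begin

lemma bracket_zero_right [simp]: "v \<in> carrier L \<Longrightarrow> bracket L v \<zero> = \<zero>"
  using bracket_smult_right[of "\<zero>\<^bsub>K\<^esub>" v \<zero>] bracket_closed by simp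

lemma bracket_skew:
  assumes "u \<in> carrier L" "v \<in> carrier L"
  shows "bracket L u v = \<ominus> bracket L v u"
proof -
  have "bracket L (u \<oplus> v) (u \<oplus> v) = \<zero>" using assms by (simp add: bracket_alternating)
  then have "bracket L u v \<oplus> bracket L v u = \<zero>"
    using assms bracket_alternating[OF assms(1)] bracket_alternating[OF assms(2)]
    by (simp add: bracket_add_left bracket_add_right bracket_closed M.a_comm)
  then show ?thesis using assms bracket_closed M.minus_equality by metis
qed

lemma bracket_mem_swap:
  assumes "subspace K W L" "u \<in> carrier L" "v \<in> carrier L" "bracket L u v \<in> W"
  shows "bracket L v u \<in> W"
  using subspace_neg[OF assms(1,4)] bracket_skew[OF assms(3,2)] by simp

lemma lie_idealD:
  assumes "lie_ideal K L J"
  shows lie_ideal_subspace: "subspace K J L"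
    and lie_ideal_left: "\<lbrakk>x \<in> carrier L; y \<in> J\<rbrakk> \<Longrightarrow> bracket L x y \<in> J"
    and lie_ideal_right: "\<lbrakk>x \<in> carrier L; y \<in> J\<rbrakk> \<Longrightarrow> bracket L y x \<in> J"
  using assms bracket_mem_swap subspace_carrier unfolding lie_ideal_def by blast+

end

section \<open>The form, orthogonal subspaces and representable functionals\<close>

context symplectic_lie_algebra
begin

lemma form_zero_left [simp]: "v \<in> carrier L \<Longrightarrow> \<omega> \<zero> v = \<zero>\<^bsub>K\<^esub>"
  using form_smult_left[of "\<zero>\<^bsub>K\<^esub>" \<zero> v] form_closed by simp

lemma form_zero_swap:
  assumes "u \<in> carrier L" "v \<in> carrier L" "\<omega> u v = \<zero>\<^bsub>K\<^esub>"
  shows "\<omega> v u = \<zero>\<^bsub>K\<^esub>"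
proof -
  have "\<omega> (u \<oplus> v) (u \<oplus> v) = \<zero>\<^bsub>K\<^esub>" using assms by (simp add: form_alternating)
  then show ?thesis
    using assms form_alternating[OF assms(1)] form_alternating[OF assms(2)]
    by (simp add: form_add_left form_add_right form_closed)
qed

lemma form_minus_left:
  assumes "u \<in> carrier L" "v \<in> carrier L" "w \<in> carrier L"
  shows "\<omega> (u \<ominus> v) w = \<omega> u w \<ominus>\<^bsub>K\<^esub> \<omega> v w"
proof -
  have "\<ominus> v = (\<ominus>\<^bsub>K\<^esub> \<one>\<^bsub>K\<^esub>) \<odot> v" using assms by (simp add: smult_l_minus)
  then have "\<omega> (\<ominus> v) w = \<ominus>\<^bsub>K\<^esub> \<omega> v w"
    using assms by (simp add: form_smult_left form_closed R.l_minus)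
  then show ?thesis using assms by (simp add: a_minus_def form_add_left)
qed

lemma form_minus_right:
  assumes "u \<in> carrier L" "v \<in> carrier L" "w \<in> carrier L"
  shows "\<omega> u (v \<ominus> w) = \<omega> u v \<ominus>\<^bsub>K\<^esub> \<omega> u w"
proof -
  have "\<ominus> w = (\<ominus>\<^bsub>K\<^esub> \<one>\<^bsub>K\<^esub>) \<odot> w" using assms by (simp add: smult_l_minus)
  then have "\<omega> u (\<ominus> w) = \<ominus>\<^bsub>K\<^esub> \<omega> u w"
    using assms by (simp add: form_smult_right form_closed R.l_minus)
  then show ?thesis using assms by (simp add: a_minus_def form_add_right)
qed

text \<open>The shape in which closedness of \<open>\<omega>\<close> is applied: two terms of the
  cyclic sum vanish because an ideal meets its orthogonal there, and the third term follows.\<close>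

lemma form_cocycle_zero:
  assumes "u \<in> carrier L" "v \<in> carrier L" "w \<in> carrier L"
    and "\<omega> (bracket L w u) v = \<zero>\<^bsub>K\<^esub>" "\<omega> (bracket L v w) u = \<zero>\<^bsub>K\<^esub>"
  shows "\<omega> (bracket L u v) w = \<zero>\<^bsub>K\<^esub>"
  using form_cocycle[OF assms(1-3)] assms by (simp add: form_closed bracket_closed)

lemma orth_iff: "v \<in> orth K L \<omega> W \<longleftrightarrow> v \<in> carrier L \<and> (\<forall>w\<in>W. \<omega> v w = \<zero>\<^bsub>K\<^esub>)"
  unfolding orth_def by auto

lemma orth_subspace:
  assumes "W \<subseteq> carrier L"
  shows "subspace K (orth K L \<omega> W) L"
  using assms by (intro subspaceI) (auto simp: orth_iff form_add_left form_smult_left subsetD)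

text \<open>For \<open>w\<close> in the ideal, \<open>[w, u]\<close> and \<open>[v, w]\<close> stay
  in \<open>J\<close>, hence are orthogonal to \<open>v\<close> and \<open>u\<close>; the cocycle
  identity does the rest.\<close>

lemma orth_bracket_closed:
  assumes J: "lie_ideal K L J" and u: "u \<in> orth K L \<omega> J" and v: "v \<in> orth K L \<omega> J"
  shows "bracket L u v \<in> orth K L \<omega> J"
proof -
  have "\<omega> (bracket L u v) w = \<zero>\<^bsub>K\<^esub>" if w: "w \<in> J" for w
  proof (rule form_cocycle_zero)
    have wc: "w \<in> carrier L" using subspace_carrier[OF lie_ideal_subspace[OF J] w] .
    show "u \<in> carrier L" "v \<in> carrier L" "w \<in> carrier L" using u v wc by (auto simp: orth_iff)
    have "bracket L w u \<in> J" "bracket L v w \<in> J"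
      using lie_idealD[OF J] u v w by (auto simp: orth_iff)
    then show "\<omega> (bracket L w u) v = \<zero>\<^bsub>K\<^esub>" "\<omega> (bracket L v w) u = \<zero>\<^bsub>K\<^esub>"
      using u v lie_ideal_subspace[OF J, THEN subspace_carrier]
      by (auto simp: orth_iff intro: form_zero_swap)
  qed
  then show ?thesis using u v by (auto simp: orth_iff bracket_closed)
qed

text \<open>A functional on a finitely generated subspace that vanishes on the radical of the restricted
  form is represented by a vector of that subspace.\<close>

lemma restrict_form_representable:
  assumes "finite B" "subspace K U L" "B \<subseteq> U" "v \<in> carrier L"
    and "\<And>y. \<lbrakk>y \<in> U; \<forall>b\<in>B. \<omega> b y = \<zero>\<^bsub>K\<^esub>\<rbrakk> \<Longrightarrow> \<omega> v y = \<zero>\<^bsub>K\<^esub>"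
  shows "\<exists>x\<in>U. \<forall>y\<in>U. \<omega> v y = \<omega> x y"
  using assms
proof (induction B arbitrary: v rule: finite_induct)
  case empty
  then show ?case
    using subspace_zero[OF empty(1)] subspace_carrier[OF empty(1)] by (intro bexI[of _ \<zero>]) auto
next
  case (insert b B)
  have U: "subspace K U L" and bU: "b \<in> U" and BU: "B \<subseteq> U" and v: "v \<in> carrier L" using insert by auto
  note Uc = subspace_carrier[OF U]
  show ?case
  proof (cases "\<forall>y\<in>U. (\<forall>b\<in>B. \<omega> b y = \<zero>\<^bsub>K\<^esub>) \<longrightarrow> \<omega> b y = \<zero>\<^bsub>K\<^esub>")
    case True
    then have "\<omega> v y = \<zero>\<^bsub>K\<^esub>" if "y \<in> U" "\<forall>b\<in>B. \<omega> b y = \<zero>\<^bsub>K\<^esub>" for y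
      using insert.prems(4)[of y] that by auto
    then show ?thesis using insert.IH[OF U BU v] by blast
  next
    case False
    then obtain y0 where y0: "y0 \<in> U" "\<forall>b\<in>B. \<omega> b y0 = \<zero>\<^bsub>K\<^esub>" "\<omega> b y0 \<noteq> \<zero>\<^bsub>K\<^esub>" by auto
    let ?c = "inv\<^bsub>K\<^esub> (\<omega> b y0)"
    have bc: "b \<in> carrier L" and y0c: "y0 \<in> carrier L" using Uc bU y0 by auto
    have "\<omega> b y0 \<in> Units K" using y0(3) field_Units form_closed[OF bc y0c] by simp
    then have c: "?c \<in> carrier K" "?c \<otimes>\<^bsub>K\<^esub> \<omega> b y0 = \<one>\<^bsub>K\<^esub>" by auto
    \<comment> \<open>The coefficient is chosen so that \<open>v - d b\<close> is orthogonal to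
      \<open>y0\<close>. It then satisfies the hypothesis for \<open>B\<close> alone.\<close>
    let ?d = "\<omega> v y0 \<otimes>\<^bsub>K\<^esub> ?c"
    let ?v = "v \<ominus> ?d \<odot> b"
    have d: "?d \<in> carrier K" using c(1) v y0c by (simp add: form_closed)
    have vc: "?v \<in> carrier L" using v d bc by simp
    have "\<omega> ?v y = \<zero>\<^bsub>K\<^esub>" if y: "y \<in> U" "\<forall>b\<in>B. \<omega> b y = \<zero>\<^bsub>K\<^esub>" for y
    proof -
      let ?e = "?c \<otimes>\<^bsub>K\<^esub> \<omega> b y"
      \<comment> \<open>Correcting \<open>y\<close> along \<open>y0\<close> makes it orthogonal to
        \<open>b\<close> too, without disturbing orthogonality to \<open>B\<close>; so the
        hypothesis on \<open>v\<close> applies to \<open>z\<close>.\<close>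
      let ?z = "y \<ominus> ?e \<odot> y0"
      have yc: "y \<in> carrier L" using Uc y by auto
      have e: "?e \<in> carrier K" using c(1) bc yc by (simp add: form_closed)
      have F: "\<omega> b y \<in> carrier K" "\<omega> b y0 \<in> carrier K" "\<omega> v y \<in> carrier K" "\<omega> v y0 \<in> carrier K"
        using bc yc y0c v by (auto simp: form_closed)
      have zU: "?z \<in> U" using U y y0(1) e by (simp add: subspace_minus subspace_smult)
      have "\<omega> b' ?z = \<zero>\<^bsub>K\<^esub>" if "b' \<in> B" for b'
      proof -
        have "b' \<in> carrier L" using that BU Uc by auto
        then have "\<omega> b' ?z = \<omega> b' y \<ominus>\<^bsub>K\<^esub> ?e \<otimes>\<^bsub>K\<^esub> \<omega> b' y0"
          using yc y0c e by (simp add: form_minus_right form_smult_right)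
        then show ?thesis using that y(2) y0(2) e by (simp add: a_minus_def)
      qed
      moreover have "\<omega> b ?z = \<zero>\<^bsub>K\<^esub>"
      proof -
        have "\<omega> b ?z = \<omega> b y \<ominus>\<^bsub>K\<^esub> ?e \<otimes>\<^bsub>K\<^esub> \<omega> b y0"
          using bc yc y0c e by (simp add: form_minus_right form_smult_right)
        also have "?e \<otimes>\<^bsub>K\<^esub> \<omega> b y0 = \<omega> b y \<otimes>\<^bsub>K\<^esub> (?c \<otimes>\<^bsub>K\<^esub> \<omega> b y0)"
          using F c(1) by (simp add: R.m_ac)
        finally show ?thesis using F c(2) by (simp add: a_minus_def R.r_neg)
      qed
      ultimately have "\<omega> v ?z = \<zero>\<^bsub>K\<^esub>" using insert.prems(4)[OF zU] by auto
      moreover have "\<omega> v ?z = \<omega> v y \<ominus>\<^bsub>K\<^esub> ?e \<otimes>\<^bsub>K\<^esub> \<omega> v y0"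
        using v yc y0c e by (simp add: form_minus_right form_smult_right)
      moreover have "\<omega> ?v y = \<omega> v y \<ominus>\<^bsub>K\<^esub> ?d \<otimes>\<^bsub>K\<^esub> \<omega> b y"
        using v bc yc d by (simp add: form_minus_left form_smult_left)
      moreover have "?d \<otimes>\<^bsub>K\<^esub> \<omega> b y = ?e \<otimes>\<^bsub>K\<^esub> \<omega> v y0" using F c(1) by (simp add: R.m_ac)
      ultimately show ?thesis by simp
    qed
    then obtain x where x: "x \<in> U" "\<forall>y\<in>U. \<omega> ?v y = \<omega> x y" using insert.IH[OF U BU vc] by blast
    show ?thesis
    proof (intro bexI[of _ "x \<oplus> ?d \<odot> b"] ballI)
      show "x \<oplus> ?d \<odot> b \<in> U" using x(1) bU d U by (simp add: subspace_add subspace_smult)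
      fix y assume y: "y \<in> U"
      have "v = ?v \<oplus> ?d \<odot> b" using v d bc by (simp add: a_minus_def M.a_ac M.r_neg)
      then have "\<omega> v y = \<omega> ?v y \<oplus>\<^bsub>K\<^esub> \<omega> (?d \<odot> b) y"
        using form_add_left[OF vc, of "?d \<odot> b" y] d bc Uc[OF y] by simp
      then show "\<omega> v y = \<omega> (x \<oplus> ?d \<odot> b) y"
        using x y Uc d bc by (simp add: form_add_left)
    qed
  qed
qed

section \<open>Vergne polarizations and their extension by one dimension\<close>

text \<open>For \<open>w\<close> in \<open>U\<close>, the bracket \<open>[w, x]\<close> lies in
  \<open>U\<close>, which is orthogonal to \<open>y\<close>, and \<open>[y, w]\<close> lies in
  \<open>U\<close>, hence in \<open>U'\<close>, which is orthogonal to \<open>x\<close>. The cocycle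
  identity then puts \<open>[x, y]\<close> in the radical of \<open>U\<close>; the case
  \<open>U = U'\<close> shows that a radical is a subalgebra.\<close>

lemma radical_bracket:
  assumes U: "lie_ideal K L U" and U': "lie_ideal K L U'" and sub: "U \<subseteq> U'"
    and x: "x \<in> U' \<inter> orth K L \<omega> U'" and y: "y \<in> U \<inter> orth K L \<omega> U"
  shows "bracket L x y \<in> U \<inter> orth K L \<omega> U"
proof -
  have xc: "x \<in> carrier L" and yc: "y \<in> carrier L" using x y by (auto simp: orth_iff)
  have "\<omega> (bracket L x y) w = \<zero>\<^bsub>K\<^esub>" if w: "w \<in> U" for w
  proof (rule form_cocycle_zero[OF xc yc])
    show "w \<in> carrier L" using subspace_carrier[OF lie_ideal_subspace[OF U] w] .
    have "bracket L w x \<in> U" "bracket L y w \<in> U" using lie_idealD[OF U] w xc yc by auto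
    then show "\<omega> (bracket L w x) y = \<zero>\<^bsub>K\<^esub>" "\<omega> (bracket L y w) x = \<zero>\<^bsub>K\<^esub>"
      using x y xc yc sub lie_ideal_subspace[OF U, THEN subspace_carrier]
      by (auto simp: orth_iff intro: form_zero_swap)
  qed
  then show ?thesis using x y lie_ideal_left[OF U] by (auto simp: orth_iff bracket_closed)
qed

text \<open>The last clause is the invariant that makes \<open>W + rad U'\<close> a subalgebra again when the flag is
  extended by an ideal \<open>U'\<close> whose restricted form has radical \<open>rad U' = U' \<inter> orth U'\<close>.\<close>

definition vergne_polarization :: "'b set \<Rightarrow> 'b set \<Rightarrow> bool" where
  "vergne_polarization U W \<longleftrightarrow>
    lie_ideal K L U \<and> lie_subalgebra K L W \<and> W \<subseteq> U \<and> W \<subseteq> orth K L \<omega> W \<and>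
    U \<inter> orth K L \<omega> W \<subseteq> W \<and>
    (\<forall>U'. lie_ideal K L U' \<and> U \<subseteq> U' \<longrightarrow>
      (\<forall>x\<in>U' \<inter> orth K L \<omega> U'. \<forall>y\<in>W. bracket L x y \<in> W))"

lemma vergne_polarization_zero: "vergne_polarization {\<zero>} {\<zero>}"
  unfolding vergne_polarization_def lie_ideal_def lie_subalgebra_def
  using zero_subspace by (auto simp: orth_iff)

text \<open>The new polarization is \<open>W\<close> plus the radical of \<open>U'\<close>. Closure
  under brackets comes from the invariant and \<open>radical_bracket\<close>. Maximality uses that
  the dimension grows by at most one, and it needs no case split on the rank of the restricted
  form.\<close>

lemma vergne_polarization_step:
  assumes pol: "vergne_polarization U W" and U': "lie_ideal K L U'" and sub: "U \<subseteq> U'"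
    and dim: "vectorspace.dim K (vs U') \<le> Suc (vectorspace.dim K (vs U))"
  shows "\<exists>W'. vergne_polarization U' W'"
proof -
  have U: "lie_ideal K L U" and W: "subspace K W L"
    and Wb: "\<And>x y. \<lbrakk>x \<in> W; y \<in> W\<rbrakk> \<Longrightarrow> bracket L x y \<in> W"
    and WU: "W \<subseteq> U" and iso: "W \<subseteq> orth K L \<omega> W" and max: "U \<inter> orth K L \<omega> W \<subseteq> W"
    and rW: "\<And>U' x y. \<lbrakk>lie_ideal K L U'; U \<subseteq> U'; x \<in> U' \<inter> orth K L \<omega> U'; y \<in> W\<rbrakk> \<Longrightarrow> bracket L x y \<in> W"
    using pol unfolding vergne_polarization_def lie_subalgebra_def by blast+
  have sU: "subspace K U L" and sU': "subspace K U' L" using U U' lie_ideal_subspace by auto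
  note Uc = subspace_carrier[OF sU] and U'c = subspace_carrier[OF sU'] and Wc = subspace_carrier[OF W]
  define R where "R = U' \<inter> orth K L \<omega> U'"
  have R: "subspace K R L"
    unfolding R_def using sU' orth_subspace[OF subspace_subset[OF sU']] by (rule subspace_Int)
  note Rc = subspace_carrier[OF R]
  define W' where "W' = subspace_sum W R"
  have W': "subspace K W' L" unfolding W'_def by (rule sum_is_subspace[OF W R])
  have WW': "W \<subseteq> W'" unfolding W'_def by (rule in_sum_vs[OF W R])
  have RW': "R \<subseteq> W'" unfolding W'_def by (subst vsum_comm[OF W R]) (rule in_sum_vs[OF R W])
  have W'_iff: "z \<in> W' \<longleftrightarrow> (\<exists>w\<in>W. \<exists>r\<in>R. z = w \<oplus> r)" for z
    unfolding W'_def submodule_sum_def by auto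
  have W'U': "W' \<subseteq> U'"
    using WU sub subspace_add[OF sU'] by (force simp: W'_iff R_def)
  have bil: "bracket L (a \<oplus> b) (c \<oplus> d) =
      (bracket L a c \<oplus> bracket L a d) \<oplus> (bracket L b c \<oplus> bracket L b d)"
    if "a \<in> carrier L" "b \<in> carrier L" "c \<in> carrier L" "d \<in> carrier L" for a b c d
    using that by (simp add: bracket_add_left) (simp add: bracket_add_right)
  \<comment> \<open>The invariant carried by \<open>W\<close>, taken at the ideal \<open>U'\<close>
    itself.\<close>
  have RW: "bracket L r w \<in> W'" if "r \<in> R" "w \<in> W" for r w
    using rW[OF U' sub] that WW' unfolding R_def by blast
  have RR: "bracket L x r \<in> W'" if "lie_ideal K L U''" "U' \<subseteq> U''" "x \<in> U'' \<inter> orth K L \<omega> U''" "r \<in> R" for U'' x r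
    using radical_bracket[OF U' that(1,2,3)] that(4) RW' unfolding R_def by blast
  have "lie_subalgebra K L W'"
    unfolding lie_subalgebra_def
  proof (intro conjI ballI W')
    fix x y assume "x \<in> W'" "y \<in> W'"
    then obtain w r w' r' where xy: "w \<in> W" "r \<in> R" "x = w \<oplus> r" "w' \<in> W" "r' \<in> R" "y = w' \<oplus> r'"
      using W'_iff by auto
    have "bracket L w r' \<in> W'" using bracket_mem_swap[OF W'] RW xy Wc Rc by blast
    moreover have "bracket L r r' \<in> W'" using RR[OF U' order_refl _ xy(5), of r] xy(2) unfolding R_def by auto
    ultimately show "bracket L x y \<in> W'"
      using xy Wb WW' RW W' Wc Rc by (simp add: bil subspace_add subsetD)
  qed
  moreover have "W' \<subseteq> orth K L \<omega> W'"
  proof -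
    have "\<omega> x y = \<zero>\<^bsub>K\<^esub>" if x: "x \<in> W'" and y: "y \<in> W'" for x y
    proof -
      obtain w r w' r' where xy: "w \<in> W" "r \<in> R" "x = w \<oplus> r" "w' \<in> W" "r' \<in> R" "y = w' \<oplus> r'"
        using W'_iff x y by auto
      have c: "w \<in> carrier L" "r \<in> carrier L" "w' \<in> carrier L" "r' \<in> carrier L"
        using xy Wc Rc by auto
      have "\<omega> w w' = \<zero>\<^bsub>K\<^esub>" "\<omega> r w' = \<zero>\<^bsub>K\<^esub>" "\<omega> r r' = \<zero>\<^bsub>K\<^esub>" "\<omega> r' w = \<zero>\<^bsub>K\<^esub>"
        using xy iso WU sub unfolding R_def by (auto simp: orth_iff)
      moreover from this have "\<omega> w r' = \<zero>\<^bsub>K\<^esub>" using c form_zero_swap by blast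
      ultimately show ?thesis using c xy by (simp add: form_add_left form_add_right)
    qed
    then show ?thesis using W' subspace_carrier by (auto simp: orth_iff)
  qed
  moreover have "U' \<inter> orth K L \<omega> W' \<subseteq> W'"
  proof
    fix v assume v: "v \<in> U' \<inter> orth K L \<omega> W'"
    then have vc: "v \<in> carrier L" using U'c by auto
    have vW: "v \<in> orth K L \<omega> W" using v WW' by (auto simp: orth_iff)
    show "v \<in> W'"
    proof (cases "v \<in> U")
      case True
      then show ?thesis using vW max WW' by auto
    next
      case False
      obtain B where B: "finite B" "B \<subseteq> U" "span B = U" by (rule subspace_finite_basis[OF finite_dimensional sU])
      \<comment> \<open>Since \<open>B\<close> spans \<open>U\<close>, such a \<open>y\<close> is in
        the radical of \<open>U\<close>. It is thus orthogonal to \<open>W\<close>, so it lies in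
        \<open>W\<close> by maximality, and \<open>v\<close> is orthogonal to
        \<open>W\<close>.\<close>
      have "\<omega> v y = \<zero>\<^bsub>K\<^esub>" if y: "y \<in> U" "\<forall>b\<in>B. \<omega> b y = \<zero>\<^bsub>K\<^esub>" for y
      proof -
        have "B \<subseteq> orth K L \<omega> {y}" using B(2) Uc y(2) by (auto simp: orth_iff)
        then have "U \<subseteq> orth K L \<omega> {y}"
          using span_is_subset[OF _ is_module[OF orth_subspace]] Uc[OF y(1)] B(3) by auto
        then have "\<omega> y u = \<zero>\<^bsub>K\<^esub>" if "u \<in> U" for u
          using that Uc y(1) form_zero_swap by (auto simp: orth_iff)
        then have "y \<in> orth K L \<omega> W" using WU Uc[OF y(1)] by (auto simp: orth_iff)
        then have "y \<in> W" using max y(1) by auto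
        then show ?thesis using vW by (simp add: orth_iff)
      qed
      then obtain x where x: "x \<in> U" "\<forall>y\<in>U. \<omega> v y = \<omega> x y"
        using restrict_form_representable[OF B(1) sU B(2) vc] by blast
      have xc: "x \<in> carrier L" using Uc x by auto
      \<comment> \<open>The splitting \<open>v = x + r\<close> is the decomposition sought:
        \<open>x\<close> will land in \<open>W\<close> and \<open>r\<close> in the radical of
        \<open>U'\<close>.\<close>
      define r where "r = v \<ominus> x"
      have rc: "r \<in> carrier L" unfolding r_def using vc xc by simp
      have rU': "r \<in> U'" unfolding r_def using v x sub sU' subspace_minus by blast
      have vr: "v = x \<oplus> r" unfolding r_def using vc xc by (simp add: a_minus_def M.a_ac M.r_neg)
      have rU: "\<omega> r u = \<zero>\<^bsub>K\<^esub>" if "u \<in> U" for u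
        unfolding r_def using that x Uc vc xc
        by (simp add: form_minus_left) (simp add: a_minus_def R.r_neg form_closed)
      \<comment> \<open>Both \<open>\<omega> r x\<close> and \<open>\<omega> r r\<close> vanish. So
        \<open>r\<close> is orthogonal to \<open>U\<close> and to \<open>v\<close>, a vector of
        \<open>U'\<close> outside \<open>U\<close>, and hence to all of \<open>U'\<close>.\<close>
      have "\<omega> r v = \<zero>\<^bsub>K\<^esub>"
        using rU[OF x(1)] form_alternating[OF rc] rc xc unfolding vr by (simp add: form_add_right)
      then have "\<omega> v r = \<zero>\<^bsub>K\<^esub>" using form_zero_swap rc vc by blast
      moreover have "U \<subseteq> orth K L \<omega> {r}" using rU Uc rc form_zero_swap by (auto simp: orth_iff)
      ultimately have "U' \<subseteq> orth K L \<omega> {r}"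
        using v vc rc False
        by (intro subspace_dim_Suc[OF finite_dimensional sU sU' sub dim]) (auto simp: orth_iff intro!: orth_subspace)
      then have "\<omega> r w = \<zero>\<^bsub>K\<^esub>" if "w \<in> U'" for w
        using that rc form_zero_swap[of w r] by (auto simp: orth_iff)
      then have "r \<in> R" unfolding R_def using rU' rc by (simp add: orth_iff)
      \<comment> \<open>On \<open>W\<close>, a subset of \<open>U\<close>, the vectors
        \<open>x\<close> and \<open>v\<close> define the same functional.\<close>
      have "\<omega> x w = \<zero>\<^bsub>K\<^esub>" if "w \<in> W" for w
        using vW x(2)[rule_format, of w] that WU by (auto simp: orth_iff)
      then have "x \<in> orth K L \<omega> W" using xc by (simp add: orth_iff)
      then have "x \<in> W" using max x(1) by auto
      with \<open>r \<in> R\<close> show ?thesis using vr unfolding W'_iff[of v] by auto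
    qed
  qed
  moreover have "bracket L x y \<in> W'"
    if U'': "lie_ideal K L U''" "U' \<subseteq> U''" "x \<in> U'' \<inter> orth K L \<omega> U''" and y: "y \<in> W'" for U'' x y
  proof -
    obtain w r where wr: "w \<in> W" "r \<in> R" "y = w \<oplus> r" using W'_iff y by auto
    have "bracket L x w \<in> W'" using rW[OF U''(1) _ U''(3) wr(1)] sub U''(2) WW' by auto
    moreover have "bracket L x r \<in> W'" by (rule RR[OF U'' wr(2)])
    moreover have "bracket L x y = bracket L x w \<oplus> bracket L x r"
      using wr Wc Rc U''(3) by (simp add: bracket_add_right orth_iff)
    ultimately show ?thesis using W' subspace_add by simp
  qed
  ultimately have "vergne_polarization U' W'"
    unfolding vergne_polarization_def using U' W'U' by (intro conjI allI impI ballI) auto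
  then show ?thesis ..
qed

lemma vergne_polarization_lagrangian:
  assumes "vergne_polarization (carrier L) W"
  shows "lagrangian_subalgebra K L \<omega> W"
proof -
  have W: "lie_subalgebra K L W" "W \<subseteq> orth K L \<omega> W" "carrier L \<inter> orth K L \<omega> W \<subseteq> W"
    using assms unfolding vergne_polarization_def by simp_all
  then have "W = orth K L \<omega> W" by (auto simp: orth_iff)
  then show ?thesis
    using W(1) unfolding lagrangian_subalgebra_def lagrangian_def lie_subalgebra_def by simp
qed

section \<open>Completely solvable algebras\<close>

text \<open>Polarizations climb the flag one ideal at a time. Its ends are identified by dimension:
  an empty basis gives \<open>F 0 = {0}\<close>, and \<open>dim\<close> independent vectors in
  \<open>F dim\<close> span the whole algebra.\<close>

lemma completely_solvable_lagrangian:
  assumes "completely_solvable K L"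
  shows "\<exists>H. lagrangian_subalgebra K L \<omega> H"
proof -
  obtain F where F: "\<And>i. i \<le> dim \<Longrightarrow> lie_ideal K L (F i)"
    and dimF: "\<And>i. i \<le> dim \<Longrightarrow> vectorspace.dim K (vs (F i)) = i"
    and inc: "\<And>i. i < dim \<Longrightarrow> F i \<subseteq> F (Suc i)"
    using assms unfolding completely_solvable_def by blast
  have "\<exists>W. vergne_polarization (F i) W" if "i \<le> dim" for i
    using that
  proof (induction i)
    case 0
    obtain B where B: "finite B" "span B = F 0" "card B = 0"
      using subspace_finite_basis[OF finite_dimensional lie_ideal_subspace[OF F[of 0]]] dimF[of 0] by auto
    then have "F 0 = {\<zero>}" using span_empty by simp
    then show ?case using vergne_polarization_zero by auto
  next
    case (Suc i)
    then obtain W where W: "vergne_polarization (F i) W" by auto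
    then show ?case using vergne_polarization_step[OF W F[of "Suc i"] inc[of i]] dimF Suc.prems by simp
  qed
  moreover have "F dim = carrier L"
  proof -
    have sF: "subspace K (F dim) L" using F[of dim] lie_ideal_subspace by simp
    obtain B where B: "finite B" "B \<subseteq> F dim" "lin_indpt B" "span B = F dim" "card B = dim"
      using subspace_finite_basis[OF finite_dimensional sF] dimF[of dim] by auto
    then have "basis B"
      using subspace_subset[OF sF] by (intro dim_li_is_basis[OF finite_dimensional]) auto
    then show ?thesis using B(4) unfolding basis_def by simp
  qed
  ultimately show ?thesis using vergne_polarization_lagrangian by (metis order_refl)
qed

section \<open>Nilpotent algebras\<close>

text \<open>As \<open>C/U\<close> is central in \<open>L/U\<close>, every subspace between
  \<open>U\<close> and \<open>C\<close> is an ideal. Adjoining spanning vectors of \<open>C\<close>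
  one by one thus gives ideals whose dimensions grow by at most one.\<close>

lemma vergne_polarization_central_extension:
  assumes pol: "vergne_polarization U W" and C: "subspace K C L" "U \<subseteq> C"
    and LC: "\<And>x y. \<lbrakk>x \<in> carrier L; y \<in> C\<rbrakk> \<Longrightarrow> bracket L x y \<in> U"
  shows "\<exists>W. vergne_polarization C W"
proof -
  obtain B where B: "finite B" "B \<subseteq> C" "span B = C"
    by (rule subspace_finite_basis[OF finite_dimensional C(1)])
  have "\<exists>U' W. vergne_polarization U' W \<and> U \<subseteq> U' \<and> D \<subseteq> U' \<and> U' \<subseteq> C" if "finite D" "D \<subseteq> C" for D
    using that
  proof (induction D rule: finite_induct)
    case empty
    then show ?case using pol C(2) by auto
  next
    case (insert d D)
    then obtain U' W where U': "vergne_polarization U' W" "U \<subseteq> U'" "D \<subseteq> U'" "U' \<subseteq> C" by auto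
    have sU': "subspace K U' L"
      using U'(1) unfolding vergne_polarization_def by (simp add: lie_ideal_subspace)
    have dC: "d \<in> C" using insert.prems by auto
    obtain U'' where U'': "subspace K U'' L" "U' \<subseteq> U''" "d \<in> U''"
      "vectorspace.dim K (vs U'') \<le> Suc (vectorspace.dim K (vs U'))"
      and least: "\<forall>S. subspace K S L \<and> U' \<subseteq> S \<and> d \<in> S \<longrightarrow> U'' \<subseteq> S"
      using subspace_extend[OF finite_dimensional sU' subspace_carrier[OF C(1) dC]]
      by (elim exE conjE) (rule that)
    have U''C: "U'' \<subseteq> C" using least C(1) U'(4) dC by simp
    \<comment> \<open>Brackets of \<open>L\<close> with \<open>U''\<close> fall into
      \<open>U\<close>, since \<open>U''\<close> is inside \<open>C\<close>, and \<open>U\<close> is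
      inside \<open>U''\<close>.\<close>
    have "lie_ideal K L U''"
      unfolding lie_ideal_def using U'' U''C U'(2) LC by blast
    then obtain W' where "vergne_polarization U'' W'"
      using vergne_polarization_step[OF U'(1) _ U''(2,4)] by blast
    then show ?case using U''C U'' U' by blast
  qed
  from this[OF B(1,2)] obtain U' W where U': "vergne_polarization U' W" "B \<subseteq> U'" "U' \<subseteq> C" by blast
  then have "subspace K U' L" unfolding vergne_polarization_def by (simp add: lie_ideal_subspace)
  then have "C \<subseteq> U'" using span_is_subset[OF U'(2)] B(3) by simp
  then have "U' = C" using U'(3) by simp
  then show ?thesis using U'(1) by auto
qed

text \<open>The two claims are proved together: being a subspace places the next generators in the
  carrier, and the inclusion nests the generating sets, hence their spans.\<close>

lemma lower_central_series_subspace_decreasing: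
  "subspace K (lower_central_series K L i) L \<and> lower_central_series K L (Suc i) \<subseteq> lower_central_series K L i"
proof -
  let ?C = "lower_central_series K L"
  let ?S = "\<lambda>i. {bracket L x y |x y. x \<in> carrier L \<and> y \<in> ?C i}"
  have span_S: "?C (Suc i) = span (?S i)" for i by (rule lower_central_series.simps)
  have S: "?S i \<subseteq> carrier L" if "subspace K (?C i) L" for i
    using subspace_carrier[OF that] by (auto intro!: bracket_closed)
  show ?thesis
  proof (induction i)
    case 0
    have "subspace K (?C 0) L" using carrier_subspace by (simp only: lower_central_series.simps)
    from span_is_subset2[OF S[OF this]] this show ?case
      by (simp only: span_S) (simp only: lower_central_series.simps)
  next
    case (Suc i)
    have "subspace K (?C (Suc i)) L"
      unfolding span_S[of i] using Suc by (intro span_is_subspace S) blast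
    moreover have "?S (Suc i) \<subseteq> ?S i" using Suc by blast
    from span_is_monotone[OF this] have "?C (Suc (Suc i)) \<subseteq> ?C (Suc i)"
      unfolding span_S[of i, symmetric] span_S[of "Suc i", symmetric] .
    ultimately show ?case by blast
  qed
qed

text \<open>The polarization is carried upwards from the zero term of the series to the whole
  algebra; each pair of consecutive terms is a central extension.\<close>

lemma nilpotent_lagrangian:
  assumes "nilpotent K L"
  shows "\<exists>H. lagrangian_subalgebra K L \<omega> H"
proof -
  let ?C = "lower_central_series K L"
  obtain n where n: "?C n = {\<zero>}" using assms unfolding nilpotent_def by auto
  have "\<exists>W. vergne_polarization (?C (n - i)) W" if "i \<le> n" for i
    using that
  proof (induction i)
    case 0
    then show ?case using n vergne_polarization_zero by auto
  next
    case (Suc i)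
    \<comment> \<open>The bound \<open>Suc i \<le> n\<close> makes this a genuine subtraction, so
      \<open>Suc j\<close> is the term already treated and \<open>j\<close> the next larger
      one.\<close>
    define j where "j = n - Suc i"
    have j: "n - i = Suc j" using Suc.prems unfolding j_def by simp
    obtain W where "vergne_polarization (?C (Suc j)) W" using Suc j by auto
    moreover have "subspace K (?C j) L" "?C (Suc j) \<subseteq> ?C j" using lower_central_series_subspace_decreasing by auto
    moreover have "bracket L x y \<in> ?C (Suc j)" if "x \<in> carrier L" "y \<in> ?C j" for x y
    proof -
      let ?S = "{bracket L x y |x y. x \<in> carrier L \<and> y \<in> ?C j}"
      have "?S \<subseteq> carrier L" 
        using lower_central_series_subspace_decreasing[of j] subspace_carrier[of "?C j"] by (auto intro!: bracket_closed)
      then have "?S \<subseteq> ?C (Suc j)" using in_own_span by simp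
      then show ?thesis using that by blast
    qed
    ultimately show ?case unfolding j_def[symmetric] by (rule vergne_polarization_central_extension)
  qed
  from this[of n] show ?thesis using vergne_polarization_lagrangian by auto
qed

section \<open>Lifting Lagrangian subalgebras through symplectic reductions\<close>

text \<open>Once the coset operations are computed on representatives, the reduction becomes a
  surjection \<open>g\<close> from \<open>orth K L \<omega> J\<close> to \<open>L'\<close>
  preserving brackets and form. The preimage of \<open>H'\<close> under \<open>g\<close> contains
  \<open>J\<close>, which confines its orthogonal to the domain of \<open>g\<close>.\<close>

lemma reduction_lagrangian_lift:
  assumes red: "is_symplectic_reduction K L \<omega> L' \<omega>'"
    and H': "lagrangian_subalgebra K L' \<omega>' H'"
  shows "\<exists>H. lagrangian_subalgebra K L \<omega> H"
proof -
  obtain J f where J: "lie_ideal K L J" and iso: "isotropic K L \<omega> J"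
    and f: "f \<in> module_hom K (reduction K L \<omega> J) L'"
      "bij_betw f (carrier (reduction K L \<omega> J)) (carrier L')"
    and fb: "\<And>X Y. \<lbrakk>X \<in> carrier (reduction K L \<omega> J); Y \<in> carrier (reduction K L \<omega> J)\<rbrakk> \<Longrightarrow>
        f (bracket (reduction K L \<omega> J) X Y) = bracket L' (f X) (f Y)"
    and f\<omega>: "\<And>X Y. \<lbrakk>X \<in> carrier (reduction K L \<omega> J); Y \<in> carrier (reduction K L \<omega> J)\<rbrakk> \<Longrightarrow>
        \<omega>' (f X) (f Y) = quotient_form \<omega> X Y"
    using red unfolding is_symplectic_reduction_def symplectic_isomorphic_def by blast
  let ?O = "orth K L \<omega> J" and ?Q = "reduction K L \<omega> J"
  have sJ: "subspace K J L" by (rule lie_ideal_subspace[OF J])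
  have O: "subspace K ?O L" by (rule orth_subspace[OF subspace_subset[OF sJ]])
  note Jc = subspace_carrier[OF sJ] and Oc = subspace_carrier[OF O]
  have JO: "J \<subseteq> ?O" using iso unfolding isotropic_def by auto
  have "additive_subgroup J L"
    using subspace_subset[OF sJ] subspace_zero[OF sJ] subspace_add[OF sJ] subspace_neg[OF sJ]
    by (intro additive_subgroupI subgroup.intro) (auto simp flip: a_inv_def)
  then interpret J: abelian_subgroup J L by (rule abelian_subgroupI3) (rule M.abelian_group_axioms)
  have coset_mem: "x \<in> J +> u \<longleftrightarrow> (\<exists>j\<in>J. x = j \<oplus> u)" for x u
    unfolding a_r_coset_def' by auto
  have coset_shift: "J +> (j \<oplus> u) = J +> u" if "j \<in> J" "u \<in> carrier L" for j u
    using J.a_repr_independence'[of "j \<oplus> u" u] that coset_mem by auto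
  have coset_self: "u \<in> J +> u" if "u \<in> carrier L" for u
    using that by (rule J.a_rcos_self)
  \<comment> \<open>Forming a coset uses only \<open>J\<close> and addition, so shrinking the
    carrier of \<open>L\<close> to \<open>?O\<close> leaves the cosets unchanged.\<close>
  have carrier_Q: "carrier ?Q = (\<lambda>u. J +> u) ` ?O"
    unfolding reduction_def lie_quotient_def by (auto simp: A_RCOSETS_def' a_r_coset_def')
  have add_Q: "(J +> u) \<oplus>\<^bsub>?Q\<^esub> (J +> v) = J +> (u \<oplus> v)" if "u \<in> ?O" "v \<in> ?O" for u v
    using J.a_rcos_sum[OF Oc[OF that(1)] Oc[OF that(2)]]
    unfolding reduction_def lie_quotient_def by (simp add: set_add_def')
  have smult_Q: "a \<odot>\<^bsub>?Q\<^esub> (J +> u) = J +> (a \<odot> u)" if "a \<in> carrier K" "u \<in> ?O" for a u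
  proof -
    have "J +> (a \<odot> x) = J +> (a \<odot> u)" if "x \<in> J +> u" for x
      using that \<open>a \<in> carrier K\<close> Oc[OF \<open>u \<in> ?O\<close>] Jc coset_shift subspace_smult[OF sJ]
      by (auto simp: coset_mem smult_r_distr)
    then have "(\<Union>x\<in>J +> u. J +> (a \<odot> x)) = J +> (a \<odot> u)"
      using coset_self[OF Oc[OF that(2)]] by blast
    then show ?thesis unfolding reduction_def lie_quotient_def by (simp add: a_r_coset_def')
  qed
  have bracket_Q: "bracket ?Q (J +> u) (J +> v) = J +> bracket L u v" if uv: "u \<in> ?O" "v \<in> ?O" for u v
  proof -
    have c: "u \<in> carrier L" "v \<in> carrier L" using uv Oc by auto
    have "J +> bracket L x y = J +> bracket L u v" if xy: "x \<in> J +> u" "y \<in> J +> v" for x y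
    proof -
      obtain i j where ij: "i \<in> J" "x = i \<oplus> u" "j \<in> J" "y = j \<oplus> v" using xy coset_mem by auto
      have ic: "i \<in> carrier L" and jc: "j \<in> carrier L" using ij Jc by auto
      \<comment> \<open>This is the discrepancy between the brackets of two choices of
        representatives; the ideal property absorbs it.\<close>
      have "bracket L i (j \<oplus> v) \<oplus> bracket L u j \<in> J"
        using ij jc c lie_idealD[OF J] subspace_add[OF sJ] by simp
      moreover have "bracket L x y = (bracket L i (j \<oplus> v) \<oplus> bracket L u j) \<oplus> bracket L u v"
        using ij ic jc c by (simp add: bracket_add_left bracket_add_right bracket_closed M.a_ac)
      ultimately show ?thesis using coset_shift c bracket_closed by simp
    qed
    then have "(\<Union>x\<in>J +> u. \<Union>y\<in>J +> v. J +> bracket L x y) = J +> bracket L u v"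
      using coset_self[OF c(1)] coset_self[OF c(2)] by blast
    then show ?thesis unfolding reduction_def lie_quotient_def by (simp add: a_r_coset_def')
  qed
  have form_Q: "quotient_form \<omega> (J +> u) (J +> v) = \<omega> u v" if uv: "u \<in> ?O" "v \<in> ?O" for u v
  proof -
    have c: "u \<in> carrier L" "v \<in> carrier L" using uv Oc by auto
    have "\<omega> x y = \<omega> u v" if xy: "x \<in> J +> u" "y \<in> J +> v" for x y
    proof -
      obtain i j where ij: "i \<in> J" "x = i \<oplus> u" "j \<in> J" "y = j \<oplus> v" using xy coset_mem by auto
      have ic: "i \<in> carrier L" and jc: "j \<in> carrier L" using ij Jc by auto
      \<comment> \<open>Isotropy of \<open>J\<close> removes the first term, orthogonality of
        \<open>u\<close> and \<open>v\<close> to \<open>J\<close> the mixed ones.\<close>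
      have "\<omega> i j = \<zero>\<^bsub>K\<^esub>" "\<omega> u j = \<zero>\<^bsub>K\<^esub>" "\<omega> v i = \<zero>\<^bsub>K\<^esub>" using ij uv JO by (auto simp: orth_iff)
      moreover from this have "\<omega> i v = \<zero>\<^bsub>K\<^esub>" using form_zero_swap c ic by blast
      ultimately show ?thesis
        using ij ic jc c by (simp add: form_add_left form_add_right form_closed)
    qed
    moreover have "(u, v) \<in> (J +> u) \<times> (J +> v)" using c coset_self by simp
    ultimately have "(\<lambda>(x, y). \<omega> x y) ` ((J +> u) \<times> (J +> v)) = {\<omega> u v}"
      by (auto simp del: mem_Sigma_iff intro!: rev_image_eqI[of "(u, v)"])
    then show ?thesis unfolding quotient_form_def by (simp only: the_elem_eq)
  qed
  define g where "g u = f (J +> u)" for u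
  have Qc: "J +> u \<in> carrier ?Q" if "u \<in> ?O" for u using carrier_Q that by auto
  have g_carrier: "g ` ?O = carrier L'"
    using f(2) unfolding g_def bij_betw_def carrier_Q image_image by simp
  have g_add: "g (u \<oplus> v) = g u \<oplus>\<^bsub>L'\<^esub> g v" if "u \<in> ?O" "v \<in> ?O" for u v
    unfolding g_def add_Q[OF that, symmetric] using f(1) Qc that unfolding module_hom_def by auto
  have g_smult: "g (a \<odot> u) = a \<odot>\<^bsub>L'\<^esub> g u" if "a \<in> carrier K" "u \<in> ?O" for a u
    unfolding g_def smult_Q[OF that, symmetric] using f(1) Qc that unfolding module_hom_def by auto
  have g_bracket: "g (bracket L u v) = bracket L' (g u) (g v)" if "u \<in> ?O" "v \<in> ?O" for u v
    unfolding g_def bracket_Q[OF that, symmetric] using fb Qc that by auto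
  have g_form: "\<omega>' (g u) (g v) = \<omega> u v" if "u \<in> ?O" "v \<in> ?O" for u v
    unfolding g_def using f\<omega> form_Q Qc that by auto
  have sH': "subspace K H' L'" and bH': "\<And>x y. \<lbrakk>x \<in> H'; y \<in> H'\<rbrakk> \<Longrightarrow> bracket L' x y \<in> H'"
    and lagH': "H' = orth K L' \<omega>' H'"
    using H' unfolding lagrangian_subalgebra_def lie_subalgebra_def lagrangian_def by auto
  \<comment> \<open>The vector space axioms of \<open>L'\<close> are part of the statement that
    \<open>H'\<close> is a subspace of it.\<close>
  interpret L': vectorspace K L' using sH' by (rule subspace.vs)
  note H'c = L'.subspace_carrier[OF sH']
  have H'_form: "\<omega>' x h = \<zero>\<^bsub>K\<^esub>" if "x \<in> H'" "h \<in> H'" for x h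
  proof -
    have "x \<in> orth K L' \<omega>' H'" using that(1) lagH' by simp
    then show ?thesis using that(2) unfolding orth_def by simp
  qed
  have H'_max: "g v \<in> H'" if "v \<in> ?O" "\<And>h. h \<in> H' \<Longrightarrow> \<omega>' (g v) h = \<zero>\<^bsub>K\<^esub>" for v
  proof -
    have "g v \<in> carrier L'" using g_carrier that(1) by auto
    then have "g v \<in> orth K L' \<omega>' H'" using that(2) unfolding orth_def by simp
    then show ?thesis using lagH' by simp
  qed
  define H where "H = {v \<in> ?O. g v \<in> H'}"
  have JH: "J \<subseteq> H"
  proof
    fix j assume j: "j \<in> J"
    \<comment> \<open>Every \<open>h\<close> lifts to a vector orthogonal to \<open>J\<close>, so
      \<open>g j\<close> is orthogonal to \<open>H'\<close> and hence lies in it; the kernel of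
      \<open>g\<close> need not be computed.\<close>
    have "\<omega>' (g j) h = \<zero>\<^bsub>K\<^esub>" if "h \<in> H'" for h
    proof -
      have "h \<in> g ` ?O" using H'c[OF that] g_carrier by simp
      then obtain v where v: "v \<in> ?O" "h = g v" by auto
      have "\<omega> j v = \<zero>\<^bsub>K\<^esub>" using v(1) j Jc[OF j] form_zero_swap[of v j] by (simp add: orth_iff)
      then show ?thesis using v g_form[of j v] j JO by auto
    qed
    then show "j \<in> H" unfolding H_def using j JO H'_max by auto
  qed
  have sH: "subspace K H L"
  proof (rule subspaceI)
    show "H \<subseteq> carrier L" unfolding H_def using Oc by auto
    show "\<zero> \<in> H" using JH subspace_zero[OF sJ] by auto
    show "v \<oplus> w \<in> H" if "v \<in> H" "w \<in> H" for v w
      using that g_add subspace_add[OF O] L'.subspace_add[OF sH'] unfolding H_def by auto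
    show "a \<odot> v \<in> H" if "a \<in> carrier K" "v \<in> H" for a v
      using that g_smult subspace_smult[OF O] L'.subspace_smult[OF sH'] unfolding H_def by auto
  qed
  have "H \<subseteq> orth K L \<omega> H"
  proof
    fix v assume v: "v \<in> H"
    then have "\<omega> v w = \<zero>\<^bsub>K\<^esub>" if "w \<in> H" for w
      using that g_form[of v w] H'_form[of "g v" "g w"] unfolding H_def by auto
    then show "v \<in> orth K L \<omega> H" using v Oc unfolding H_def by (auto simp: orth_iff)
  qed
  moreover have "orth K L \<omega> H \<subseteq> H"
  proof
    fix v assume v: "v \<in> orth K L \<omega> H"
    \<comment> \<open>Orthogonals reverse the inclusion of \<open>J\<close> in \<open>H\<close>, so
      \<open>g\<close> may be applied to \<open>v\<close>.\<close>
    then have vO: "v \<in> ?O" using JH by (auto simp: orth_iff)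
    have "\<omega>' (g v) h = \<zero>\<^bsub>K\<^esub>" if h: "h \<in> H'" for h
    proof -
      have "h \<in> g ` ?O" using H'c[OF h] g_carrier by simp
      then obtain w where w: "w \<in> ?O" "h = g w" by auto
      then have "w \<in> H" using h unfolding H_def by auto
      then show ?thesis using v w g_form[OF vO w(1)] by (auto simp: orth_iff)
    qed
    then show "v \<in> H" unfolding H_def using vO H'_max by simp
  qed
  moreover have "bracket L x y \<in> H" if "x \<in> H" "y \<in> H" for x y
    using that g_bracket bH' orth_bracket_closed[OF J] unfolding H_def by auto
  ultimately have "lagrangian_subalgebra K L \<omega> H"
    unfolding lagrangian_subalgebra_def lie_subalgebra_def lagrangian_def using sH by blast
  then show ?thesis ..
qed

lemma trivial_lagrangian:
  assumes "carrier L = {\<zero>}"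
  shows "lagrangian_subalgebra K L \<omega> {\<zero>}"
  unfolding lagrangian_subalgebra_def lie_subalgebra_def lagrangian_def
  using zero_subspace assms bracket_closed by (auto simp: orth_def)

end

text \<open>Downward induction along the chain: the zero subspace serves for the trivial last term,
  and each reduction is lifted in turn until the initial algebra is reached.\<close>

lemma completely_reducible_lagrangian:
  assumes "completely_reducible K L \<omega>"
  shows "\<exists>H. lagrangian_subalgebra K L \<omega> H"
proof -
  obtain n :: nat and Ls \<omega>s where start: "Ls 0 = L" "\<omega>s 0 = \<omega>"
    and symp: "\<And>i. i \<le> n \<Longrightarrow> symplectic_lie_algebra K (Ls i) (\<omega>s i)"
    and red: "\<And>i. i < n \<Longrightarrow> is_symplectic_reduction K (Ls i) (\<omega>s i) (Ls (Suc i)) (\<omega>s (Suc i))"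
    and fin: "carrier (Ls n) = {\<zero>\<^bsub>Ls n\<^esub>}"
    using assms unfolding completely_reducible_def by blast
  have "\<exists>H. lagrangian_subalgebra K (Ls i) (\<omega>s i) H" if "i \<le> n" for i
    using that
  proof (induction i rule: inc_induct)
    case base
    show ?case using symplectic_lie_algebra.trivial_lagrangian[OF symp[OF order_refl] fin] by blast
  next
    case (step i)
    then obtain H where "lagrangian_subalgebra K (Ls (Suc i)) (\<omega>s (Suc i)) H" by blast
    then show ?case
      using step.hyps symplectic_lie_algebra.reduction_lagrangian_lift[OF symp red] by simp
  qed
  from this[of 0] show ?thesis using start by simp
qed

theorem corollary3p13:
  fixes K :: "('a, 'r) ring_scheme"
    and L :: "('a, 'b) lie_algebra"
    and \<omega> :: "'b \<Rightarrow> 'b \<Rightarrow> 'a"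
  assumes "symplectic_lie_algebra K L \<omega>"
  shows "(completely_reducible K L \<omega> \<longrightarrow> (\<exists>H. lagrangian_subalgebra K L \<omega> H)) \<and>
         (completely_solvable K L \<longrightarrow> (\<exists>H. lagrangian_subalgebra K L \<omega> H)) \<and>
         (nilpotent K L \<longrightarrow> (\<exists>H. lagrangian_subalgebra K L \<omega> H))"
  using completely_reducible_lagrangian
    symplectic_lie_algebra.completely_solvable_lagrangian[OF assms]
    symplectic_lie_algebra.nilpotent_lagrangian[OF assms]
  by blast

end
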